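(* Suppose that at every step of the joint bidiagonalization (JBD) process, carried out in finite precision, the inner least squares problem is solved accurately, and let $x_i^{(k)}=R^{-1}V_kw_i^{(k)}$, where $w_i^{(k)}$ is the right singular vector of $B_k$ corresponding to its singular value $c_i^{(k)}$. Then $$\big\|[(s_i^{(k)})^2A^TA-(c_i^{(k)})^2L^TL]x_i^{(k)}\big\|\le\|R\|\left(\alpha_{k+1}\beta_{k+1}|e_k^Tw_i^{(k)}|+O(\|\underline B_k^{-1}\|\epsilon)\right).$$
   Context: Setting. $A\in\mathbb{R}^{m\times n}$, $L\in\mathbb{R}^{p\times n}$ with $\mathrm{rank}\begin{pmatrix}A\\L\end{pmatrix}=n$. The compact QR factorization is $\begin{pmatrix}A\\L\end{pmatrix}=QR$ with $Q=\begin{pmatrix}Q_A\\Q_L\end{pmatrix}$, $Q^TQ=I_n$, $Q_A\in\mathbb{R}^{m\times n}$, $Q_L\in\mathbb{R}^{p\times n}$, $R\in\mathbb{R}^{n\times n}$ nonsingular. $\|\cdot\|$ is the 2-norm, $\epsilon$ is the unit roundoff, and $e_j$ with $j=k$ or $k+1$ is the last column of $I_j$. JBD process (exact form). $\beta_1u_1=b$; $\alpha_1\tilde v_1=QQ^T(u_1^T,0_p^T)^T$; and for $i\ge 1$: $\beta_{i+1}u_{i+1}=\tilde v_i(1{:}m)-\alpha_iu_i$; $\alpha_{i+1}\tilde v_{i+1}=QQ^T(u_{i+1}^T,0_p^T)^T-\beta_{i+1}\tilde v_i$; the $\alpha_i,\beta_i$ are nonnegative normalization factors. The vector $QQ^T(u_i^T,0_p^T)^T$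 is obtained by solving the inner least squares problem $\min_x\|\begin{pmatrix}A\\L\end{pmatrix}x-\begin{pmatrix}u_i\\0_p\end{pmatrix}\|$. Notation (computed quantities). $U_{k+1}=(u_1,\dots,u_{k+1})\in\mathbb{R}^{m\times(k+1)}$, $\widetilde V_k=(\tilde v_1,\dots,\tilde v_k)\in\mathbb{R}^{(m+p)\times k}$; all $u_i,\tilde v_i$ have unit length. $B_k\in\mathbb{R}^{(k+1)\times k}$ is lower bidiagonal with diagonal $\alpha_1,\dots,\alpha_k$ and subdiagonal $\beta_2,\dots,\beta_{k+1}$. $\underline{B}_k=\begin{pmatrix}B_{k-1}^T\\ \alpha_ke_k^T\end{pmatrix}\in\mathbb{R}^{k\times k}$ is upper bidiagonal with diagonal $\alpha_1,\dots,\alpha_k$ and superdiagonal $\beta_2,\dots,\beta_k$, assumed invertible. $v_i=Q^T\tilde v_i$ and $V_k=(v_1,\dots,v_k)$. Finite precision model (with accurate inner solves). Only rounding errors in the JBD process are considered: the computed quantities satisfy $(I_m,0_{m\times p})\widetilde V_k=U_{k+1}B_k+\widetilde F_k$ and $QQ^T\begin{pmatrix}U_{k+1}\\0_{p\times(k+1)}\end{pmatrix}=\widetilde V_kB_k^T+\alpha_{k+1}\tilde v_{k+1}e_{k+1}^T+\widetilde G_{k+1}$, with $\|\widetilde F_k\|,\|\widetilde G_{k+1}\|=O(\epsilon)$. Local orthogonality: $\beta_{i+1}|u_{i+1}^Tu_i|=O(c_1\epsilon)$, with $c_1=c_1(m,n)$ a modest constant; no $\beta_{i+1}$ is negligible.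 The compact SVD of the computed $B_k$ is taken to be exact: $B_k=P_k\Theta_kW_k^T$, $\Theta_k=\mathrm{diag}(c_1^{(k)},\dots,c_k^{(k)})$, $1\ge c_1^{(k)}>\dots>c_k^{(k)}\ge0$, $P_k\in\mathbb{R}^{(k+1)\times k}$ with orthonormal columns, $W_k=(w_1^{(k)},\dots,w_k^{(k)})\in\mathbb{R}^{k\times k}$ orthogonal; and $(s_i^{(k)})^2=1-(c_i^{(k)})^2$. Convention. $X=O(Y)$ means $|X|\le KY$ for a modest constant $K$ that does not depend on $\epsilon$ or on $\|\underline B_k^{-1}\|$ (it may depend on $k$ and $c_1$), with $\epsilon$ sufficiently small. *)

theory Defs
  imports
    Complex_Main
    "Jordan_Normal_Form.DL_Rank"
    "Jordan_Normal_Form.Gauss_Jordan_Elimination"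
begin

definition vec_norm2 :: "real vec \<Rightarrow> real" where
  "vec_norm2 x = sqrt (x \<bullet> x)"

definition mat_norm2 :: "real mat \<Rightarrow> real" where
  "mat_norm2 A = (SUP x \<in> {x \<in> carrier_vec (dim_col A). vec_norm2 x \<le> 1}. vec_norm2 (A *\<^sub>v x))"

text \<open>Only used for invertible arguments.\<close>

definition mat_inv :: "real mat \<Rightarrow> real mat" where
  "mat_inv A = the (mat_inverse A)"

definition compact_QR ::
  "nat \<Rightarrow> nat \<Rightarrow> nat \<Rightarrow> real mat \<Rightarrow> real mat \<Rightarrow> real mat \<Rightarrow> real mat \<Rightarrow> real mat \<Rightarrow> bool" where
  "compact_QR m n p A L Q\<^sub>A Q\<^sub>L R \<longleftrightarrow>
     Q\<^sub>A \<in> carrier_mat m n \<and> Q\<^sub>L \<in> carrier_mat p n \<and> R \<in> carrier_mat n n \<and>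
     (Q\<^sub>A @\<^sub>r Q\<^sub>L)\<^sup>T * (Q\<^sub>A @\<^sub>r Q\<^sub>L) = 1\<^sub>m n \<and>
     upper_triangular R \<and> invertible_mat R \<and>
     A @\<^sub>r L = (Q\<^sub>A @\<^sub>r Q\<^sub>L) * R"

text \<open>The sequences \<open>u\<close>, \<open>v\<close>, \<open>\<alpha>\<close>, \<open>\<beta>\<close>, and the
  singular values \<open>c\<close> below, are indexed from \<open>1\<close> as in the mathematics, whereas
  matrix and vector entries are indexed from \<open>0\<close>. Thus \<open>first_cols N x j\<close> is
  the \<open>N \<times> j\<close> matrix with columns \<open>x 1, \<dots>, x j\<close>, and entry \<open>(i, i)\<close> of
  \<open>B_mat \<alpha> \<beta> k\<close> is \<open>\<alpha> (i + 1)\<close> while entry \<open>(j + 1, j)\<close> is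
  \<open>\<beta> (j + 2)\<close>.\<close>

definition first_cols :: "nat \<Rightarrow> (nat \<Rightarrow> real vec) \<Rightarrow> nat \<Rightarrow> real mat" where
  "first_cols N x j = mat_of_cols N (map x [1..<j + 1])"

definition last_unit :: "nat \<Rightarrow> real vec" where
  "last_unit j = unit_vec j (j - 1)"

definition B_mat :: "(nat \<Rightarrow> real) \<Rightarrow> (nat \<Rightarrow> real) \<Rightarrow> nat \<Rightarrow> real mat" where
  "B_mat \<alpha> \<beta> k = mat (k + 1) k
     (\<lambda>(i, j). if i = j then \<alpha> (i + 1) else if i = j + 1 then \<beta> (i + 1) else 0)"

text \<open>The square upper bidiagonal matrix obtained by putting the row
  \<open>\<alpha>\<^sub>k e\<^sub>k\<^sup>T\<close> below the transpose of \<open>B\<^bsub>k-1\<^esub>\<close>.\<close>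

definition Bu_mat :: "(nat \<Rightarrow> real) \<Rightarrow> (nat \<Rightarrow> real) \<Rightarrow> nat \<Rightarrow> real mat" where
  "Bu_mat \<alpha> \<beta> k = (B_mat \<alpha> \<beta> (k - 1))\<^sup>T @\<^sub>r mat_of_rows k [\<alpha> k \<cdot>\<^sub>v last_unit k]"

text \<open>Finite precision model of the first \<open>k\<close> steps of the joint bidiagonalization
  with accurate inner least squares solves: accuracy of the solves means that the
  vectors \<open>Q Q\<^sup>T (u\<^sub>i; 0)\<close> enter the second recurrence with an error that is part of
  \<open>G\<close>. Here \<open>v\<close> is the sequence of the vectors of length \<open>m + p\<close>. The
  starting vector enters only through its normalization \<open>u 1\<close>.
  \<open>C\<^sub>F\<close>, \<open>C\<^sub>G\<close>, \<open>C\<^sub>o\<close> are the constants hidden in the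
  \<open>O(\<epsilon>)\<close> and \<open>O(c\<^sub>1 \<epsilon>)\<close> terms, and \<open>\<delta>\<close> is a threshold
  below which a subdiagonal element counts as negligible.\<close>

definition JBD_finite_precision ::
  "nat \<Rightarrow> nat \<Rightarrow> nat \<Rightarrow> nat \<Rightarrow> real \<Rightarrow> real \<Rightarrow> real \<Rightarrow> real \<Rightarrow> real \<Rightarrow> real \<Rightarrow> real mat \<Rightarrow>
   (nat \<Rightarrow> real vec) \<Rightarrow> (nat \<Rightarrow> real vec) \<Rightarrow> (nat \<Rightarrow> real) \<Rightarrow> (nat \<Rightarrow> real) \<Rightarrow>
   real mat \<Rightarrow> real mat \<Rightarrow> bool" where
  "JBD_finite_precision m n p k C\<^sub>F C\<^sub>G C\<^sub>o c1 \<delta> \<epsilon> Q u v \<alpha> \<beta> F G \<longleftrightarrow>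
     (\<forall>i\<in>{1..k + 1}. u i \<in> carrier_vec m \<and> vec_norm2 (u i) = 1) \<and>
     (\<forall>i\<in>{1..k + 1}. v i \<in> carrier_vec (m + p) \<and> vec_norm2 (v i) = 1) \<and>
     (\<forall>i\<in>{1..k + 1}. 0 \<le> \<alpha> i \<and> 0 \<le> \<beta> i) \<and>
     F \<in> carrier_mat m k \<and> G \<in> carrier_mat (m + p) (k + 1) \<and>
     four_block_mat (1\<^sub>m m) (0\<^sub>m m p) (0\<^sub>m 0 m) (0\<^sub>m 0 p) * first_cols (m + p) v k
       = first_cols m u (k + 1) * B_mat \<alpha> \<beta> k + F \<and>
     Q * Q\<^sup>T * (first_cols m u (k + 1) @\<^sub>r 0\<^sub>m p (k + 1))
       = first_cols (m + p) v k * (B_mat \<alpha> \<beta> k)\<^sup>T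
         + \<alpha> (k + 1) \<cdot>\<^sub>m (mat_of_cols (m + p) [v (k + 1)] * mat_of_rows (k + 1) [last_unit (k + 1)])
         + G \<and>
     mat_norm2 F \<le> C\<^sub>F * \<epsilon> \<and> mat_norm2 G \<le> C\<^sub>G * \<epsilon> \<and>
     (\<forall>i\<in>{1..k}. \<beta> (i + 1) * \<bar>u (i + 1) \<bullet> u i\<bar> \<le> C\<^sub>o * (c1 * \<epsilon>)) \<and>
     (\<forall>i\<in>{1..k}. \<delta> \<le> \<beta> (i + 1))"

definition compact_SVD_B ::
  "nat \<Rightarrow> real mat \<Rightarrow> real mat \<Rightarrow> (nat \<Rightarrow> real) \<Rightarrow> real mat \<Rightarrow> bool" where
  "compact_SVD_B k B P c W \<longleftrightarrow>
     P \<in> carrier_mat (k + 1) k \<and> P\<^sup>T * P = 1\<^sub>m k \<and>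
     W \<in> carrier_mat k k \<and> W\<^sup>T * W = 1\<^sub>m k \<and>
     (\<forall>i\<in>{1..k}. 0 \<le> c i \<and> c i \<le> 1) \<and>
     (\<forall>i\<in>{1..k}. \<forall>j\<in>{1..k}. i < j \<longrightarrow> c j < c i) \<and>
     B = P * mat_diag k (\<lambda>j. c (j + 1)) * W\<^sup>T"

definition approx_gsv_vector ::
  "nat \<Rightarrow> nat \<Rightarrow> real mat \<Rightarrow> real mat \<Rightarrow> (nat \<Rightarrow> real vec) \<Rightarrow> real mat \<Rightarrow> nat \<Rightarrow> real vec" where
  "approx_gsv_vector n k Q R v W i =
     mat_inv R *\<^sub>v (first_cols n (\<lambda>j. Q\<^sup>T *\<^sub>v v j) k *\<^sub>v col W (i - 1))"

end

theory Submission
  imports Defs "HOL-Analysis.L2_Norm"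
begin

text \<open>
  Let \<open>x = R\<inverse> y\<close> with \<open>y = V\<^sub>k w\<close>, where \<open>w\<close> is a right singular vector of \<open>B = B\<^sub>k\<close> for the
  singular value \<open>c\<close>.  Since \<open>A\<^sup>T A + L\<^sup>T L = R\<^sup>T R\<close> and \<open>A = Q\<^sub>A R\<close>, the identity \<open>s\<^sup>2 + c\<^sup>2 = 1\<close>
  turns the residual of the generalized problem into
  \<open>R\<^sup>T (Q\<^sub>A\<^sup>T Q\<^sub>A - c\<^sup>2) y\<close> (lemma \<open>gsv_residual_eq\<close>).  This accounts for the factor \<open>\<parallel>R\<parallel>\<close> and leaves an
  estimate that involves only \<open>Q\<close>.

  Let \<open>J = (I, 0)\<close> select the upper \<open>m\<close> components, so that \<open>Q\<^sub>A = J Q\<close> and \<open>(U; 0) = J\<^sup>T U\<close>, and put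
  \<open>q = V w\<close>, where \<open>V\<close> now has the long vectors as columns, so that \<open>y = Q\<^sup>T q\<close>.  If \<open>q\<close> were in the
  range of \<open>Q\<close> and there were no rounding errors, then \<open>Q\<^sub>A y = J q = U B w\<close> by the first recurrence, and
  the second one, applied to \<open>B w\<close>, would give \<open>Q\<^sub>A\<^sup>T U B w = Q\<^sup>T V B\<^sup>T B w + \<dots> = c\<^sup>2 y + \<dots>\<close>, where the
  dots are the term of length at most \<open>\<alpha>\<^sub>k\<^sub>+\<^sub>1 \<beta>\<^sub>k\<^sub>+\<^sub>1 \<bar>e\<^sub>k\<^sup>T w\<bar>\<close> that comes from the last column.

  With rounding errors the delicate point is that \<open>q\<close> leaves the range of \<open>Q\<close>.  The
  first \<open>k\<close> columns of \<open>B\<^sup>T\<close> form the square matrix \<open>Bu_mat\<close>, hence \<open>w = B\<^sup>T z\<close>, where \<open>z\<close> is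
  \<open>Bu_mat\<inverse> w\<close> padded by a zero.  The second recurrence, applied to \<open>z\<close>, exhibits \<open>q\<close> as a vector in the
  range of \<open>Q\<close> minus \<open>G z\<close>, and \<open>\<parallel>z\<parallel> \<le> \<parallel>Bu_mat\<inverse>\<parallel>\<close>; this is where the inverse enters the bound.
  Lemma \<open>perturbed_projection_residual\<close> collects all perturbations.  Finally \<open>B\<close> is a contraction, which
  gives \<open>1 = \<parallel>B\<^sup>T z\<parallel> \<le> \<parallel>z\<parallel> \<le> \<parallel>Bu_mat\<inverse>\<parallel>\<close>, so the errors of plain order \<open>\<epsilon>\<close> are absorbed in
  \<open>\<parallel>Bu_mat\<inverse>\<parallel> \<epsilon>\<close>.
\<close>

section \<open>The Euclidean norm of vectors and the spectral norm of matrices\<close>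

lemma vec_norm2_L2_set: "vec_norm2 x = L2_set (vec_index x) {0..<dim_vec x}"
  unfolding vec_norm2_def L2_set_def scalar_prod_def by (simp add: power2_eq_square)

lemma vec_norm2_nonneg [simp]: "0 \<le> vec_norm2 x"
  by (simp add: vec_norm2_L2_set)

lemma vec_norm2_square: "(vec_norm2 x)\<^sup>2 = x \<bullet> x"
  unfolding vec_norm2_def by (simp add: scalar_prod_def sum_nonneg)

lemma vec_norm2_zero [simp]: "vec_norm2 (0\<^sub>v n) = 0"
  unfolding vec_norm2_def by simp

lemma vec_norm2_unit_vec: "i < n \<Longrightarrow> vec_norm2 (unit_vec n i) = 1"
  unfolding vec_norm2_def by simp

lemma vec_norm2_smult: "vec_norm2 (c \<cdot>\<^sub>v x) = \<bar>c\<bar> * vec_norm2 x"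
  unfolding vec_norm2_def
  by (simp add: scalar_prod_smult_distrib[of _ "dim_vec x"] real_sqrt_mult mult.assoc[symmetric])

lemma vec_norm2_triangle:
  assumes "x \<in> carrier_vec n" "y \<in> carrier_vec n"
  shows "vec_norm2 (x + y) \<le> vec_norm2 x + vec_norm2 y"
proof -
  have "vec_norm2 (x + y) = L2_set (\<lambda>i. x $ i + y $ i) {0..<n}"
    unfolding vec_norm2_L2_set using assms by (intro L2_set_cong) auto
  also have "\<dots> \<le> L2_set (vec_index x) {0..<n} + L2_set (vec_index y) {0..<n}"
    by (rule L2_set_triangle_ineq)
  finally show ?thesis using assms by (simp add: vec_norm2_L2_set)
qed

lemma vec_norm2_minus_le:
  assumes "x \<in> carrier_vec n" "y \<in> carrier_vec n"
  shows "vec_norm2 (x - y) \<le> vec_norm2 x + vec_norm2 y"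
proof -
  have "x - y = x + (-1) \<cdot>\<^sub>v y" using assms by auto
  moreover have "vec_norm2 (x + (-1) \<cdot>\<^sub>v y) \<le> vec_norm2 x + vec_norm2 ((-1) \<cdot>\<^sub>v y)"
    by (rule vec_norm2_triangle) (use assms in auto)
  ultimately show ?thesis by (simp add: vec_norm2_smult)
qed

lemma abs_scalar_prod_le:
  assumes "x \<in> carrier_vec n" "y \<in> carrier_vec n"
  shows "\<bar>x \<bullet> y\<bar> \<le> vec_norm2 x * vec_norm2 y"
proof -
  have "\<bar>x \<bullet> y\<bar> \<le> (\<Sum>i = 0..<n. \<bar>x $ i\<bar> * \<bar>y $ i\<bar>)"
    unfolding scalar_prod_def using assms by (simp add: sum_abs abs_mult[symmetric])
  also have "\<dots> \<le> L2_set (vec_index x) {0..<n} * L2_set (vec_index y) {0..<n}"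
    by (rule L2_set_mult_ineq)
  finally show ?thesis using assms by (simp add: vec_norm2_L2_set)
qed

text \<open>The spectral norm is a supremum of reals, which says nothing unless the set is bounded.  The sum of
  the lengths of the rows is a crude bound, by the Cauchy-Schwarz inequality.\<close>

lemma bdd_above_mat_norm2:
  "bdd_above ((\<lambda>x. vec_norm2 (A *\<^sub>v x)) ` {x \<in> carrier_vec (dim_col A). vec_norm2 x \<le> 1})"
proof (rule bdd_aboveI2)
  fix x :: "real vec"
  assume "x \<in> {x \<in> carrier_vec (dim_col A). vec_norm2 x \<le> 1}"
  then have x: "x \<in> carrier_vec (dim_col A)" "vec_norm2 x \<le> 1" by auto
  have "vec_norm2 (A *\<^sub>v x) \<le> (\<Sum>i = 0..<dim_row A. \<bar>(A *\<^sub>v x) $ i\<bar>)"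
    unfolding vec_norm2_L2_set using L2_set_le_sum_abs[of "vec_index (A *\<^sub>v x)"]
    by (simp del: index_mult_mat_vec)
  also have "\<dots> \<le> (\<Sum>i = 0..<dim_row A. vec_norm2 (row A i))"
  proof (rule sum_mono)
    fix i assume i: "i \<in> {0..<dim_row A}"
    then have "\<bar>(A *\<^sub>v x) $ i\<bar> \<le> vec_norm2 (row A i) * vec_norm2 x"
      using abs_scalar_prod_le[of "row A i" "dim_col A" x] x by simp
    also have "\<dots> \<le> vec_norm2 (row A i)"
      using mult_left_mono[OF x(2), of "vec_norm2 (row A i)"] by simp
    finally show "\<bar>(A *\<^sub>v x) $ i\<bar> \<le> vec_norm2 (row A i)" .
  qed
  finally show "vec_norm2 (A *\<^sub>v x) \<le> (\<Sum>i = 0..<dim_row A. vec_norm2 (row A i))" .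
qed

lemma mat_norm2_nonneg: "0 \<le> mat_norm2 A"
proof -
  have "vec_norm2 (A *\<^sub>v 0\<^sub>v (dim_col A)) \<le> mat_norm2 A"
    unfolding mat_norm2_def by (rule cSUP_upper[OF _ bdd_above_mat_norm2]) auto
  then show ?thesis using vec_norm2_nonneg order_trans by blast
qed

lemma vec_norm2_mult_mat_vec_le:
  assumes A: "A \<in> carrier_mat m n" and x: "x \<in> carrier_vec n"
  shows "vec_norm2 (A *\<^sub>v x) \<le> mat_norm2 A * vec_norm2 x"
proof (cases "vec_norm2 x = 0")
  case True
  then have "\<forall>i\<in>{0..<n}. x $ i = 0"
    using x by (simp add: vec_norm2_L2_set L2_set_eq_0_iff)
  then have "x = 0\<^sub>v n" using x by (intro eq_vecI) auto
  moreover have "A *\<^sub>v 0\<^sub>v n = 0\<^sub>v m" using A by auto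
  ultimately show ?thesis by simp
next
  case False
  let ?c = "vec_norm2 x"
  have c: "?c > 0" using False vec_norm2_nonneg[of x] by linarith
  let ?y = "inverse ?c \<cdot>\<^sub>v x"
  have "vec_norm2 (A *\<^sub>v ?y) \<le> mat_norm2 A"
    unfolding mat_norm2_def
    by (rule cSUP_upper[OF _ bdd_above_mat_norm2]) (use A x c in \<open>auto simp: vec_norm2_smult\<close>)
  moreover have "vec_norm2 (A *\<^sub>v ?y) = inverse ?c * vec_norm2 (A *\<^sub>v x)"
    using mult_mat_vec[OF A x, of "inverse ?c"] c by (simp add: vec_norm2_smult)
  ultimately have "inverse ?c * vec_norm2 (A *\<^sub>v x) \<le> mat_norm2 A" by simp
  then show ?thesis using c by (simp add: field_simps)
qed

text \<open>A transpose obeys the norm bounds of the matrix itself, because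
  \<open>\<parallel>A\<^sup>T y\<parallel>\<^sup>2 = y \<bullet> A (A\<^sup>T y) \<le> \<parallel>y\<parallel> C \<parallel>A\<^sup>T y\<parallel>\<close>.\<close>

lemma vec_norm2_transpose_mult_le:
  assumes A: "A \<in> carrier_mat m n" and y: "y \<in> carrier_vec m" and C: "0 \<le> C"
    and bound: "\<And>x. x \<in> carrier_vec n \<Longrightarrow> vec_norm2 (A *\<^sub>v x) \<le> C * vec_norm2 x"
  shows "vec_norm2 (A\<^sup>T *\<^sub>v y) \<le> C * vec_norm2 y"
proof (cases "vec_norm2 (A\<^sup>T *\<^sub>v y) = 0")
  case True
  then show ?thesis using C by simp
next
  case False
  let ?z = "A\<^sup>T *\<^sub>v y"
  have z: "?z \<in> carrier_vec n" using A y by auto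
  have "(vec_norm2 ?z)\<^sup>2 = y \<bullet> (A *\<^sub>v ?z)"
    unfolding vec_norm2_square by (rule transpose_vec_mult_scalar[OF A z y])
  also have "\<dots> \<le> vec_norm2 y * vec_norm2 (A *\<^sub>v ?z)"
    using abs_scalar_prod_le[OF y, of "A *\<^sub>v ?z"] A z by fastforce
  also have "\<dots> \<le> vec_norm2 y * (C * vec_norm2 ?z)"
    by (intro mult_left_mono bound z) simp
  finally have "vec_norm2 ?z * vec_norm2 ?z \<le> (C * vec_norm2 y) * vec_norm2 ?z"
    by (simp add: power2_eq_square algebra_simps)
  then show ?thesis using False vec_norm2_nonneg[of ?z]
    by (simp add: mult_le_cancel_right)
qed

lemma vec_norm2_isometry:
  assumes Q: "Q \<in> carrier_mat m n" and QQ: "Q\<^sup>T * Q = 1\<^sub>m n" and x: "x \<in> carrier_vec n"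
  shows "vec_norm2 (Q *\<^sub>v x) = vec_norm2 x"
proof -
  have "(Q *\<^sub>v x) \<bullet> (Q *\<^sub>v x) = (Q\<^sup>T *\<^sub>v (Q *\<^sub>v x)) \<bullet> x"
    using transpose_vec_mult_scalar[OF Q x, of "Q *\<^sub>v x"] Q x by simp
  also have "Q\<^sup>T *\<^sub>v (Q *\<^sub>v x) = x"
    using assoc_mult_mat_vec[of "Q\<^sup>T" n m Q n x] Q x QQ by simp
  finally show ?thesis unfolding vec_norm2_def by simp
qed

lemma vec_norm2_isometry_transpose_le:
  assumes Q: "Q \<in> carrier_mat m n" and QQ: "Q\<^sup>T * Q = 1\<^sub>m n" and y: "y \<in> carrier_vec m"
  shows "vec_norm2 (Q\<^sup>T *\<^sub>v y) \<le> vec_norm2 y"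
  using vec_norm2_transpose_mult_le[OF Q y, of 1] vec_norm2_isometry[OF Q QQ] by simp

lemma mat_inv_inverse:
  assumes A: "A \<in> carrier_mat n n" and inv: "invertible_mat A"
  shows "mat_inv A \<in> carrier_mat n n" "A * mat_inv A = 1\<^sub>m n" "mat_inv A * A = 1\<^sub>m n"
proof -
  obtain B where B: "A * B = 1\<^sub>m (dim_row A)" "B * A = 1\<^sub>m (dim_row B)"
    using inv unfolding invertible_mat_def inverts_mat_def by auto
  have "dim_col B = n" "dim_row B = n"
    using arg_cong[OF B(1), of dim_col] arg_cong[OF B(2), of dim_col] A by auto
  then have "B \<in> carrier_mat n n" by auto
  then have "A \<in> Units (ring_mat TYPE(real) n ())"
    using A B by (auto simp: Units_def ring_mat_def)
  then obtain C where C: "mat_inverse A = Some C"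
    using mat_inverse(1)[OF A, where b = "()"] by (cases "mat_inverse A") auto
  then show "mat_inv A \<in> carrier_mat n n" "A * mat_inv A = 1\<^sub>m n" "mat_inv A * A = 1\<^sub>m n"
    using mat_inverse(2)[OF A C] by (auto simp: mat_inv_def)
qed

section \<open>Perturbed two-sided recurrences with a projector\<close>

text \<open>
  The recurrences are needed only on three vectors: \<open>q\<close>, a coordinate vector with image \<open>a\<close>, and
  another one with image \<open>b\<close> whose only purpose is to show that \<open>q\<close> is within \<open>g'\<close> of the range of the
  projector \<open>Q Q\<^sup>T\<close>.  Indeed \<open>q + g'\<close> is fixed by the projector, hence \<open>Q Q\<^sup>T q = q + e\<close> with
  \<open>e = g' - Q Q\<^sup>T g'\<close>.  Then \<open>J Q Q\<^sup>T q = a + f + J e\<close>, and applying \<open>Q\<^sup>T J\<^sup>T\<close> turns \<open>a\<close> into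
  \<open>\<sigma> Q\<^sup>T q + \<tau> Q\<^sup>T v + Q\<^sup>T g\<close>.  The bound follows because \<open>Q\<^sup>T\<close> and \<open>J\<close> do not increase
  lengths; the factor 2 is the triangle inequality for \<open>e\<close>.
\<close>

lemma perturbed_projection_residual:
  fixes q f g g' v :: "real vec"
  assumes Q: "Q \<in> carrier_mat N n" and QQ: "Q\<^sup>T * Q = 1\<^sub>m n"
    and J: "J \<in> carrier_mat m N" and JJ: "J * J\<^sup>T = 1\<^sub>m m"
    and vecs: "q \<in> carrier_vec N" "v \<in> carrier_vec N" "g \<in> carrier_vec N" "g' \<in> carrier_vec N"
      "a \<in> carrier_vec m" "b \<in> carrier_vec m" "f \<in> carrier_vec m"
    and Jq: "J *\<^sub>v q = a + f"
    and Pa: "Q *\<^sub>v (Q\<^sup>T *\<^sub>v (J\<^sup>T *\<^sub>v a)) = \<sigma> \<cdot>\<^sub>v q + \<tau> \<cdot>\<^sub>v v + g"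
    and Pb: "Q *\<^sub>v (Q\<^sup>T *\<^sub>v (J\<^sup>T *\<^sub>v b)) = q + g'"
  shows "vec_norm2 (Q\<^sup>T *\<^sub>v (J\<^sup>T *\<^sub>v (J *\<^sub>v (Q *\<^sub>v (Q\<^sup>T *\<^sub>v q)))) - \<sigma> \<cdot>\<^sub>v (Q\<^sup>T *\<^sub>v q))
    \<le> \<bar>\<tau>\<bar> * vec_norm2 v + vec_norm2 g + vec_norm2 f + 2 * vec_norm2 g'"
proof -
  have QT: "Q\<^sup>T \<in> carrier_mat n N" and JT: "J\<^sup>T \<in> carrier_mat N m" using Q J by auto
  have QTQ: "Q\<^sup>T *\<^sub>v (Q *\<^sub>v x) = x" if "x \<in> carrier_vec n" for x
    using assoc_mult_mat_vec[OF QT Q that] QQ that by simp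
  have contr_Q: "vec_norm2 (Q\<^sup>T *\<^sub>v x) \<le> vec_norm2 x" if "x \<in> carrier_vec N" for x
    using vec_norm2_isometry_transpose_le[OF Q QQ that] .
  have contr_J: "vec_norm2 (J *\<^sub>v x) \<le> vec_norm2 x" if "x \<in> carrier_vec N" for x
    using vec_norm2_isometry_transpose_le[OF JT _ that] JJ by simp
  have iso_J: "vec_norm2 (J\<^sup>T *\<^sub>v x) = vec_norm2 x" if "x \<in> carrier_vec m" for x
    using vec_norm2_isometry[OF JT _ that] JJ by simp
  define e where "e = g' - Q *\<^sub>v (Q\<^sup>T *\<^sub>v g')"
  have e: "e \<in> carrier_vec N" unfolding e_def using vecs Q by auto
  have "vec_norm2 (Q *\<^sub>v (Q\<^sup>T *\<^sub>v g')) \<le> vec_norm2 g'"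
    using vec_norm2_isometry[OF Q QQ, of "Q\<^sup>T *\<^sub>v g'"] contr_Q vecs QT by simp
  then have e_le: "vec_norm2 e \<le> 2 * vec_norm2 g'"
    unfolding e_def using vec_norm2_minus_le[of g' N "Q *\<^sub>v (Q\<^sup>T *\<^sub>v g')"] vecs Q by simp
  have "Q *\<^sub>v (Q\<^sup>T *\<^sub>v (q + g')) = q + g'"
    unfolding Pb[symmetric] using QTQ vecs Q JT by simp
  moreover have "Q *\<^sub>v (Q\<^sup>T *\<^sub>v (q + g')) = Q *\<^sub>v (Q\<^sup>T *\<^sub>v q) + Q *\<^sub>v (Q\<^sup>T *\<^sub>v g')"
    using vecs Q QT by (simp add: mult_add_distrib_mat_vec[OF QT] mult_add_distrib_mat_vec[OF Q])
  ultimately have sum: "Q *\<^sub>v (Q\<^sup>T *\<^sub>v q) + Q *\<^sub>v (Q\<^sup>T *\<^sub>v g') = q + g'" by simp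
  have Pq: "Q *\<^sub>v (Q\<^sup>T *\<^sub>v q) = q + e"
  proof (rule eq_vecI)
    fix i assume "i < dim_vec (q + e)"
    then have i: "i < N" using e by simp
    then show "(Q *\<^sub>v (Q\<^sup>T *\<^sub>v q)) $ i = (q + e) $ i"
      using arg_cong[OF sum, of "\<lambda>x. x $ i"] vecs Q
      by (simp add: e_def del: index_mult_mat_vec)
  qed (use vecs Q e in auto)
  have fe: "f + J *\<^sub>v e \<in> carrier_vec m" using vecs J e by auto
  have "J *\<^sub>v (Q *\<^sub>v (Q\<^sup>T *\<^sub>v q)) = a + (f + J *\<^sub>v e)"
    unfolding Pq mult_add_distrib_mat_vec[OF J vecs(1) e] Jq
    by (rule assoc_add_vec) (use vecs J e in auto)
  then have "Q\<^sup>T *\<^sub>v (J\<^sup>T *\<^sub>v (J *\<^sub>v (Q *\<^sub>v (Q\<^sup>T *\<^sub>v q))))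
      = Q\<^sup>T *\<^sub>v (J\<^sup>T *\<^sub>v a) + Q\<^sup>T *\<^sub>v (J\<^sup>T *\<^sub>v (f + J *\<^sub>v e))"
    using vecs fe JT QT
    by (simp add: mult_add_distrib_mat_vec[OF JT vecs(5) fe] mult_add_distrib_mat_vec[OF QT])
  also have "Q\<^sup>T *\<^sub>v (J\<^sup>T *\<^sub>v a) = Q\<^sup>T *\<^sub>v (\<sigma> \<cdot>\<^sub>v q + \<tau> \<cdot>\<^sub>v v + g)"
    unfolding Pa[symmetric] using QTQ vecs QT JT by simp
  also have "\<dots> = \<sigma> \<cdot>\<^sub>v (Q\<^sup>T *\<^sub>v q) + \<tau> \<cdot>\<^sub>v (Q\<^sup>T *\<^sub>v v) + Q\<^sup>T *\<^sub>v g"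
    using vecs QT
    by (simp add: mult_add_distrib_mat_vec[OF QT, of "_ + _"] mult_add_distrib_mat_vec[OF QT]
        mult_mat_vec[OF QT] assoc_add_vec[of _ n])
  finally have "Q\<^sup>T *\<^sub>v (J\<^sup>T *\<^sub>v (J *\<^sub>v (Q *\<^sub>v (Q\<^sup>T *\<^sub>v q)))) - \<sigma> \<cdot>\<^sub>v (Q\<^sup>T *\<^sub>v q)
      = \<tau> \<cdot>\<^sub>v (Q\<^sup>T *\<^sub>v v) + Q\<^sup>T *\<^sub>v g + Q\<^sup>T *\<^sub>v (J\<^sup>T *\<^sub>v (f + J *\<^sub>v e))"
    using QT by (intro eq_vecI) (simp_all del: index_mult_mat_vec)
  also have "vec_norm2 \<dots> \<le> vec_norm2 (\<tau> \<cdot>\<^sub>v (Q\<^sup>T *\<^sub>v v) + Q\<^sup>T *\<^sub>v g)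
      + vec_norm2 (Q\<^sup>T *\<^sub>v (J\<^sup>T *\<^sub>v (f + J *\<^sub>v e)))"
    by (rule vec_norm2_triangle[of _ n]) (use QT JT fe vecs in auto)
  also have "\<dots> \<le> \<bar>\<tau>\<bar> * vec_norm2 v + vec_norm2 g + (vec_norm2 f + 2 * vec_norm2 g')"
  proof (rule add_mono)
    have "vec_norm2 (\<tau> \<cdot>\<^sub>v (Q\<^sup>T *\<^sub>v v) + Q\<^sup>T *\<^sub>v g)
        \<le> vec_norm2 (\<tau> \<cdot>\<^sub>v (Q\<^sup>T *\<^sub>v v)) + vec_norm2 (Q\<^sup>T *\<^sub>v g)"
      by (rule vec_norm2_triangle[of _ n]) (use QT vecs in auto)
    also have "\<dots> \<le> \<bar>\<tau>\<bar> * vec_norm2 v + vec_norm2 g"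
      unfolding vec_norm2_smult by (intro add_mono mult_left_mono contr_Q vecs) simp
    finally show "vec_norm2 (\<tau> \<cdot>\<^sub>v (Q\<^sup>T *\<^sub>v v) + Q\<^sup>T *\<^sub>v g) \<le> \<bar>\<tau>\<bar> * vec_norm2 v + vec_norm2 g" .
    have "vec_norm2 (Q\<^sup>T *\<^sub>v (J\<^sup>T *\<^sub>v (f + J *\<^sub>v e))) \<le> vec_norm2 (f + J *\<^sub>v e)"
      using contr_Q[of "J\<^sup>T *\<^sub>v (f + J *\<^sub>v e)"] iso_J[OF fe] JT fe by simp
    also have "\<dots> \<le> vec_norm2 f + vec_norm2 (J *\<^sub>v e)"
      by (rule vec_norm2_triangle[of _ m]) (use vecs J e in auto)
    also have "\<dots> \<le> vec_norm2 f + 2 * vec_norm2 g'"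
      using contr_J[OF e] e_le by simp
    finally show "vec_norm2 (Q\<^sup>T *\<^sub>v (J\<^sup>T *\<^sub>v (f + J *\<^sub>v e))) \<le> vec_norm2 f + 2 * vec_norm2 g'" .
  qed
  finally show ?thesis by simp
qed

section \<open>Stacked matrices\<close>

lemma smult_mat_mult_vec:
  fixes A :: "real mat"
  assumes "A \<in> carrier_mat m n" "x \<in> carrier_vec n"
  shows "(c \<cdot>\<^sub>m A) *\<^sub>v x = c \<cdot>\<^sub>v (A *\<^sub>v x)"
  using assms by (intro eq_vecI) auto

lemma append_rows_gram:
  fixes A B :: "real mat"
  assumes A: "A \<in> carrier_mat m n" and B: "B \<in> carrier_mat p n"
  shows "(A @\<^sub>r B)\<^sup>T * (A @\<^sub>r B) = A\<^sup>T * A + B\<^sup>T * B"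
proof (rule eq_matI)
  fix i j assume "i < dim_row (A\<^sup>T * A + B\<^sup>T * B)" "j < dim_col (A\<^sup>T * A + B\<^sup>T * B)"
  then have ij: "i < n" "j < n" using B by auto
  have col: "col (A @\<^sub>r B) l = col A l @\<^sub>v col B l" if "l < n" for l
    unfolding append_rows_def
    by (rule col_four_block_mat(1)) (use A B that in auto)
  have AB: "A @\<^sub>r B \<in> carrier_mat (m + p) n" using A B by auto
  have "((A @\<^sub>r B)\<^sup>T * (A @\<^sub>r B)) $$ (i, j) = (col A i @\<^sub>v col B i) \<bullet> (col A j @\<^sub>v col B j)"
    using AB ij by (simp add: col[symmetric])
  also have "\<dots> = col A i \<bullet> col A j + col B i \<bullet> col B j"
    by (rule scalar_prod_append[of _ m _ p]) (use A B ij in auto)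
  finally show "((A @\<^sub>r B)\<^sup>T * (A @\<^sub>r B)) $$ (i, j) = (A\<^sup>T * A + B\<^sup>T * B) $$ (i, j)"
    using A B ij by simp
qed (use A B in \<open>auto simp: append_rows_def\<close>)

text \<open>The matrix \<open>(I\<^sub>m, 0)\<close>, with the empty lower blocks that are required to build it from four blocks.\<close>

definition top_block :: "nat \<Rightarrow> nat \<Rightarrow> real mat" where
  "top_block m p = four_block_mat (1\<^sub>m m) (0\<^sub>m m p) (0\<^sub>m 0 m) (0\<^sub>m 0 p)"

lemma top_block_carrier: "top_block m p \<in> carrier_mat m (m + p)"
  using four_block_carrier_mat[of "1\<^sub>m m" m m "0\<^sub>m 0 p" 0 p] by (simp add: top_block_def)

lemma top_block_dim [simp]: "dim_row (top_block m p) = m" "dim_col (top_block m p) = m + p"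
  using top_block_carrier[of m p] by auto

lemma row_top_block: "i < m \<Longrightarrow> row (top_block m p) i = unit_vec (m + p) i"
  by (intro eq_vecI) (auto simp: top_block_def unit_vec_def)

lemma top_block_mult_append_rows:
  assumes A: "A \<in> carrier_mat m n" and B: "B \<in> carrier_mat p n"
  shows "top_block m p * (A @\<^sub>r B) = A"
proof (rule eq_matI)
  fix i j assume "i < dim_row A" "j < dim_col A"
  then show "(top_block m p * (A @\<^sub>r B)) $$ (i, j) = A $$ (i, j)"
    using A B carrier_append_rows[OF A B]
    by (simp add: row_top_block append_rows_def)
qed (use A B in \<open>auto simp: append_rows_def\<close>)

lemma top_block_transpose: "(top_block m p)\<^sup>T = 1\<^sub>m m @\<^sub>r 0\<^sub>m p m"
  unfolding append_rows_def
  by (intro eq_matI) (auto simp: top_block_def)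

lemma top_block_transpose_mult:
  assumes U: "U \<in> carrier_mat m l"
  shows "(top_block m p)\<^sup>T * U = U @\<^sub>r 0\<^sub>m p l"
proof -
  have "(1\<^sub>m m @\<^sub>r 0\<^sub>m p m) * U = U @\<^sub>r (0\<^sub>m p l :: real mat)"
  proof (rule eq_matI)
    fix i j assume "i < dim_row (U @\<^sub>r 0\<^sub>m p l)" "j < dim_col (U @\<^sub>r 0\<^sub>m p l)"
    then have ij: "i < m + p" "j < l" using carrier_append_rows[OF U, of "0\<^sub>m p l" p] by auto
    have "row (1\<^sub>m m @\<^sub>r 0\<^sub>m p m) i = (if i < m then unit_vec m i else (0\<^sub>v m :: real vec))"
      using ij unfolding append_rows_def by (intro eq_vecI) (auto simp: unit_vec_def)
    then show "((1\<^sub>m m @\<^sub>r 0\<^sub>m p m) * U) $$ (i, j) = (U @\<^sub>r 0\<^sub>m p l) $$ (i, j)"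
      using ij U by (auto simp: append_rows_def)
  qed (use U in \<open>auto simp: append_rows_def\<close>)
  then show ?thesis by (simp add: top_block_transpose)
qed

lemma top_block_coisometry: "top_block m p * (top_block m p)\<^sup>T = 1\<^sub>m m"
  unfolding top_block_transpose by (rule top_block_mult_append_rows) auto

section \<open>The bidiagonal matrices and their singular vectors\<close>

lemma last_unit_carrier [simp]: "last_unit j \<in> carrier_vec j"
  by (simp add: last_unit_def)

lemma B_mat_carrier [simp]: "B_mat \<alpha> \<beta> k \<in> carrier_mat (k + 1) k"
  by (simp add: B_mat_def)

lemma Bu_mat_carrier:
  assumes "1 \<le> k" shows "Bu_mat \<alpha> \<beta> k \<in> carrier_mat k k"
proof -
  have "(B_mat \<alpha> \<beta> (k - 1))\<^sup>T \<in> carrier_mat (k - 1) k"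
    using B_mat_carrier[of \<alpha> \<beta> "k - 1"] assms by simp
  then have "Bu_mat \<alpha> \<beta> k \<in> carrier_mat (k - 1 + 1) k"
    unfolding Bu_mat_def by (intro carrier_append_rows) auto
  then show ?thesis using assms by simp
qed

lemma Bu_mat_index:
  assumes "1 \<le> k" "i < k" "j < k"
  shows "Bu_mat \<alpha> \<beta> k $$ (i, j) = B_mat \<alpha> \<beta> k $$ (j, i)"
  using assms
  by (auto simp: Bu_mat_def append_rows_def B_mat_def mat_of_rows_index last_unit_def)

text \<open>By the previous lemma \<open>Bu_mat\<close> consists of the first \<open>k\<close> columns of the transposed \<open>B_mat\<close>, and the
  zero entry removes the remaining column.\<close>

lemma B_mat_transpose_mult_append_zero:
  assumes k: "1 \<le> k" and y: "y \<in> carrier_vec k"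
  shows "(B_mat \<alpha> \<beta> k)\<^sup>T *\<^sub>v (y @\<^sub>v 0\<^sub>v 1) = Bu_mat \<alpha> \<beta> k *\<^sub>v y"
proof (rule eq_vecI)
  have dims: "dim_row (B_mat \<alpha> \<beta> k) = k + 1" "dim_col (B_mat \<alpha> \<beta> k) = k"
    "dim_row (Bu_mat \<alpha> \<beta> k) = k" "dim_col (Bu_mat \<alpha> \<beta> k) = k"
    using Bu_mat_carrier[OF k, of \<alpha> \<beta>] by (auto simp: B_mat_def)
  fix i assume "i < dim_vec (Bu_mat \<alpha> \<beta> k *\<^sub>v y)"
  then have i: "i < k" using dims by simp
  show "((B_mat \<alpha> \<beta> k)\<^sup>T *\<^sub>v (y @\<^sub>v 0\<^sub>v 1)) $ i = (Bu_mat \<alpha> \<beta> k *\<^sub>v y) $ i"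
    using i k y by (simp add: dims scalar_prod_def Bu_mat_index)
qed (use Bu_mat_carrier[OF k, of \<alpha> \<beta>] in \<open>auto simp: B_mat_def\<close>)

lemma vec_norm2_append_zero: "y \<in> carrier_vec k \<Longrightarrow> vec_norm2 (y @\<^sub>v 0\<^sub>v l) = vec_norm2 y"
  unfolding vec_norm2_def by (simp add: scalar_prod_append[of _ k _ l])

lemma last_unit_append_zero:
  assumes "y \<in> carrier_vec k" shows "last_unit (k + 1) \<bullet> (y @\<^sub>v 0\<^sub>v 1) = 0"
proof -
  have "y @\<^sub>v 0\<^sub>v 1 \<in> carrier_vec (k + 1)" using assms by (intro append_carrier_vec) auto
  then have "unit_vec (k + 1) k \<bullet> (y @\<^sub>v 0\<^sub>v 1) = (y @\<^sub>v 0\<^sub>v 1) $ k"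
    by (rule scalar_prod_left_unit) simp
  then show ?thesis using assms by (simp add: last_unit_def)
qed

lemma last_unit_B_mat_mult:
  assumes k: "1 \<le> k" and w: "w \<in> carrier_vec k"
  shows "last_unit (k + 1) \<bullet> (B_mat \<alpha> \<beta> k *\<^sub>v w) = \<beta> (k + 1) * (last_unit k \<bullet> w)"
proof -
  have "row (B_mat \<alpha> \<beta> k) k = \<beta> (k + 1) \<cdot>\<^sub>v last_unit k"
    using k by (intro eq_vecI) (auto simp: B_mat_def last_unit_def)
  then show ?thesis
    using k w scalar_prod_left_unit[of "B_mat \<alpha> \<beta> k *\<^sub>v w" "k + 1" k] B_mat_carrier[of \<alpha> \<beta> k]
    by (simp add: last_unit_def smult_scalar_prod_distrib[of _ k] del: scalar_prod_left_unit)
qed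

lemma mat_diag_mult_vec:
  fixes f :: "nat \<Rightarrow> real"
  assumes "x \<in> carrier_vec k" shows "mat_diag k f *\<^sub>v x = vec k (\<lambda>i. f i * x $ i)"
proof (rule eq_vecI)
  fix i assume "i < dim_vec (vec k (\<lambda>i. f i * x $ i))"
  then have i: "i < k" by simp
  have "row (mat_diag k f) i = f i \<cdot>\<^sub>v unit_vec k i"
    using i by (intro eq_vecI) (auto simp: mat_diag_def)
  then show "(mat_diag k f *\<^sub>v x) $ i = vec k (\<lambda>i. f i * x $ i) $ i"
    using i assms by (simp add: mat_diag_def smult_scalar_prod_distrib[of _ k])
qed (simp add: mat_diag_def)

lemma compact_SVD_B_mult_vec:
  assumes svd: "compact_SVD_B k B P c W" and x: "x \<in> carrier_vec k"
  shows "B *\<^sub>v x = P *\<^sub>v (mat_diag k (\<lambda>j. c (j + 1)) *\<^sub>v (W\<^sup>T *\<^sub>v x))"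
proof -
  let ?D = "mat_diag k (\<lambda>j. c (j + 1))"
  have P: "P \<in> carrier_mat (k + 1) k" and WT: "W\<^sup>T \<in> carrier_mat k k" and B: "B = P * ?D * W\<^sup>T"
    using svd by (auto simp: compact_SVD_B_def)
  have PD: "P * ?D \<in> carrier_mat (k + 1) k" using P mat_diag_dim by (rule mult_carrier_mat)
  show ?thesis
    unfolding B assoc_mult_mat_vec[OF PD WT x]
    by (rule assoc_mult_mat_vec[OF P mat_diag_dim mult_mat_vec_carrier[OF WT x]])
qed

lemma compact_SVD_B_transpose_mult_vec:
  assumes svd: "compact_SVD_B k B P c W" and x: "x \<in> carrier_vec (k + 1)"
  shows "B\<^sup>T *\<^sub>v x = W *\<^sub>v (mat_diag k (\<lambda>j. c (j + 1)) *\<^sub>v (P\<^sup>T *\<^sub>v x))"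
proof -
  let ?D = "mat_diag k (\<lambda>j. c (j + 1))"
  have P: "P \<in> carrier_mat (k + 1) k" and W: "W \<in> carrier_mat k k" and B: "B = P * ?D * W\<^sup>T"
    using svd by (auto simp: compact_SVD_B_def)
  have WT: "W\<^sup>T \<in> carrier_mat k k" and PT: "P\<^sup>T \<in> carrier_mat k (k + 1)" using P W by auto
  have DT: "?D\<^sup>T = ?D" by (intro eq_matI) (auto simp: mat_diag_def)
  have PD: "P * ?D \<in> carrier_mat (k + 1) k" using P mat_diag_dim by (rule mult_carrier_mat)
  have "B\<^sup>T = W * (?D * P\<^sup>T)"
    unfolding B transpose_mult[OF PD WT] transpose_mult[OF P mat_diag_dim] DT by simp
  then show ?thesis
    using assoc_mult_mat_vec[OF W mult_carrier_mat[OF mat_diag_dim PT] x]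
      assoc_mult_mat_vec[OF mat_diag_dim PT x] by simp
qed

text \<open>All singular values are at most 1.\<close>

lemma compact_SVD_B_contraction:
  assumes svd: "compact_SVD_B k B P c W" and x: "x \<in> carrier_vec k"
  shows "vec_norm2 (B *\<^sub>v x) \<le> vec_norm2 x"
proof -
  let ?D = "mat_diag k (\<lambda>j. c (j + 1))"
  have P: "P \<in> carrier_mat (k + 1) k" "P\<^sup>T * P = 1\<^sub>m k"
    and W: "W \<in> carrier_mat k k" "W\<^sup>T * W = 1\<^sub>m k"
    and c: "\<And>j. j < k \<Longrightarrow> 0 \<le> c (j + 1) \<and> c (j + 1) \<le> 1"
    using svd by (auto simp: compact_SVD_B_def)
  define y where "y = W\<^sup>T *\<^sub>v x"
  have y: "y \<in> carrier_vec k" unfolding y_def using W x by auto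
  have Dy: "?D *\<^sub>v y \<in> carrier_vec k"
    using y mult_mat_vec_carrier[OF mat_diag_dim] by blast
  have "B *\<^sub>v x = P *\<^sub>v (?D *\<^sub>v y)"
    unfolding y_def by (rule compact_SVD_B_mult_vec[OF svd x])
  then have "vec_norm2 (B *\<^sub>v x) = vec_norm2 (?D *\<^sub>v y)"
    using vec_norm2_isometry[OF P Dy] by simp
  also have "\<dots> = L2_set (\<lambda>i. c (i + 1) * y $ i) {0..<k}"
    unfolding mat_diag_mult_vec[OF y] vec_norm2_L2_set by (intro L2_set_cong) auto
  also have "\<dots> \<le> L2_set (vec_index y) {0..<k}"
    unfolding L2_set_def
  proof (intro real_sqrt_le_mono sum_mono)
    fix i assume "i \<in> {0..<k}"
    then have "(c (i + 1))\<^sup>2 \<le> 1" using c[of i] by (simp add: power_le_one)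
    then show "(c (i + 1) * y $ i)\<^sup>2 \<le> (y $ i)\<^sup>2"
      by (simp add: power_mult_distrib mult_left_le_one_le)
  qed
  also have "\<dots> = vec_norm2 y" using y by (simp add: vec_norm2_L2_set)
  also have "\<dots> \<le> vec_norm2 x"
    unfolding y_def by (rule vec_norm2_isometry_transpose_le[OF W x])
  finally show ?thesis .
qed

lemma compact_SVD_B_singular_vector:
  assumes svd: "compact_SVD_B k B P c W" and i: "i \<in> {1..k}"
  shows "col W (i - 1) \<in> carrier_vec k" "vec_norm2 (col W (i - 1)) = 1"
    "B\<^sup>T *\<^sub>v (B *\<^sub>v col W (i - 1)) = (c i)\<^sup>2 \<cdot>\<^sub>v col W (i - 1)"
proof -
  let ?D = "mat_diag k (\<lambda>j. c (j + 1))" and ?e = "unit_vec k (i - 1) :: real vec"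
  have ik: "i - 1 < k" using i by auto
  have P: "P \<in> carrier_mat (k + 1) k" "P\<^sup>T * P = 1\<^sub>m k"
    and W: "W \<in> carrier_mat k k" "W\<^sup>T * W = 1\<^sub>m k"
    using svd by (auto simp: compact_SVD_B_def)
  have D: "?D \<in> carrier_mat k k" by simp
  have e: "?e \<in> carrier_vec k" by simp
  have We: "W *\<^sub>v ?e = col W (i - 1)" using W ik by (intro eq_vecI) auto
  have De: "?D *\<^sub>v ?e = c i \<cdot>\<^sub>v ?e"
    unfolding mat_diag_mult_vec[OF e] using i by (intro eq_vecI) (auto simp: unit_vec_def)
  have WT: "W\<^sup>T \<in> carrier_mat k k" and PT: "P\<^sup>T \<in> carrier_mat k (k + 1)" using P W by auto
  show w: "col W (i - 1) \<in> carrier_vec k" using W ik by auto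
  show "vec_norm2 (col W (i - 1)) = 1"
    using vec_norm2_isometry[OF W e] ik We by (simp add: vec_norm2_unit_vec)
  have WTw: "W\<^sup>T *\<^sub>v (W *\<^sub>v ?e) = ?e"
    using assoc_mult_mat_vec[OF WT W(1) e] W by simp
  have PTP: "P\<^sup>T *\<^sub>v (P *\<^sub>v ?e) = ?e"
    using assoc_mult_mat_vec[OF PT P(1) e] P by simp
  have Pe: "P *\<^sub>v ?e \<in> carrier_vec (k + 1)" using P by simp
  have "B *\<^sub>v (W *\<^sub>v ?e) = P *\<^sub>v (c i \<cdot>\<^sub>v ?e)"
    using compact_SVD_B_mult_vec[OF svd mult_mat_vec_carrier[OF W(1) e]] unfolding WTw De .
  then have "B *\<^sub>v (W *\<^sub>v ?e) = c i \<cdot>\<^sub>v (P *\<^sub>v ?e)"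
    unfolding mult_mat_vec[OF P(1) e] .
  moreover have "B\<^sup>T *\<^sub>v (c i \<cdot>\<^sub>v (P *\<^sub>v ?e)) = c i \<cdot>\<^sub>v (c i \<cdot>\<^sub>v (W *\<^sub>v ?e))"
    using compact_SVD_B_transpose_mult_vec[OF svd smult_carrier_vec[THEN iffD2, OF Pe], of "c i"]
    unfolding mult_mat_vec[OF PT Pe] PTP mult_mat_vec[OF D e] De
    unfolding mult_mat_vec[OF W(1) smult_carrier_vec[THEN iffD2, OF e]] mult_mat_vec[OF W(1) e] .
  ultimately have "B\<^sup>T *\<^sub>v (B *\<^sub>v (W *\<^sub>v ?e)) = c i \<cdot>\<^sub>v (c i \<cdot>\<^sub>v (W *\<^sub>v ?e))" by simp
  then show "B\<^sup>T *\<^sub>v (B *\<^sub>v col W (i - 1)) = (c i)\<^sup>2 \<cdot>\<^sub>v col W (i - 1)"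
    unfolding We by (simp add: smult_smult_assoc power2_eq_square)
qed

section \<open>The residual of an approximate generalized singular pair\<close>

text \<open>With \<open>\<sigma> = 1 - \<gamma>\<close> the matrix on the left is \<open>A\<^sup>T A - \<gamma> (A\<^sup>T A + L\<^sup>T L)\<close>, and the Gram matrix of the
  stacked matrix is \<open>R\<^sup>T R\<close>.  Thus \<open>L\<close> disappears and \<open>R\<^sup>T\<close> can be factored out.\<close>

lemma gsv_residual_eq:
  fixes A L R :: "real mat" and y :: "real vec"
  assumes A: "A \<in> carrier_mat m n" and L: "L \<in> carrier_mat p n"
    and qr: "compact_QR m n p A L Q\<^sub>A Q\<^sub>L R"
    and y: "y \<in> carrier_vec n" and sc: "\<sigma> = 1 - \<gamma>"
  shows "(\<sigma> \<cdot>\<^sub>m (A\<^sup>T * A) - \<gamma> \<cdot>\<^sub>m (L\<^sup>T * L)) *\<^sub>v (mat_inv R *\<^sub>v y)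
    = R\<^sup>T *\<^sub>v (Q\<^sub>A\<^sup>T *\<^sub>v (Q\<^sub>A *\<^sub>v y) - \<gamma> \<cdot>\<^sub>v y)"
proof -
  define Q where "Q = Q\<^sub>A @\<^sub>r Q\<^sub>L"
  have QA: "Q\<^sub>A \<in> carrier_mat m n" and QL: "Q\<^sub>L \<in> carrier_mat p n" and R: "R \<in> carrier_mat n n"
    and inv: "invertible_mat R" and QQ: "Q\<^sup>T * Q = 1\<^sub>m n" and AL: "A @\<^sub>r L = Q * R"
    using qr by (auto simp: compact_QR_def Q_def)
  have Q: "Q \<in> carrier_mat (m + p) n" unfolding Q_def using QA QL by (rule carrier_append_rows)
  have RT: "R\<^sup>T \<in> carrier_mat n n" and QT: "Q\<^sup>T \<in> carrier_mat n (m + p)"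
    and QAT: "Q\<^sub>A\<^sup>T \<in> carrier_mat n m" using R Q QA by auto
  have AA: "A\<^sup>T * A \<in> carrier_mat n n" and LL: "L\<^sup>T * L \<in> carrier_mat n n" using A L by auto
  define x where "x = mat_inv R *\<^sub>v y"
  have x: "x \<in> carrier_vec n" unfolding x_def using mat_inv_inverse(1)[OF R inv] y by simp
  have Rx: "R *\<^sub>v x = y"
    unfolding x_def using assoc_mult_mat_vec[OF R mat_inv_inverse(1)[OF R inv] y]
      mat_inv_inverse(2)[OF R inv] y by simp
  have "A = top_block m p * (Q * R)"
    unfolding AL[symmetric] using top_block_mult_append_rows[OF A L] by simp
  also have "\<dots> = (top_block m p * Q) * R"
    using assoc_mult_mat[OF top_block_carrier Q R] by simp
  also have "top_block m p * Q = Q\<^sub>A"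
    unfolding Q_def by (rule top_block_mult_append_rows[OF QA QL])
  finally have A_eq: "A = Q\<^sub>A * R" .
  have "A\<^sup>T * A + L\<^sup>T * L = (Q * R)\<^sup>T * (Q * R)"
    unfolding AL[symmetric] by (rule append_rows_gram[OF A L, symmetric])
  also have "\<dots> = R\<^sup>T * (Q\<^sup>T * (Q * R))"
    unfolding transpose_mult[OF Q R] by (rule assoc_mult_mat[OF RT QT mult_carrier_mat[OF Q R]])
  also have "Q\<^sup>T * (Q * R) = R"
    using assoc_mult_mat[OF QT Q R] QQ R by simp
  finally have "A\<^sup>T * A + L\<^sup>T * L = R\<^sup>T * R" .
  then have "(A\<^sup>T * A) *\<^sub>v x + (L\<^sup>T * L) *\<^sub>v x = (R\<^sup>T * R) *\<^sub>v x"
    using add_mult_distrib_mat_vec[OF AA LL x] by simp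
  also have "\<dots> = R\<^sup>T *\<^sub>v y" unfolding assoc_mult_mat_vec[OF RT R x] Rx ..
  finally have sum: "(A\<^sup>T * A) *\<^sub>v x + (L\<^sup>T * L) *\<^sub>v x = R\<^sup>T *\<^sub>v y" .
  have Ax: "A *\<^sub>v x = Q\<^sub>A *\<^sub>v y"
    unfolding A_eq assoc_mult_mat_vec[OF QA R x] Rx ..
  have AT: "A\<^sup>T = R\<^sup>T * Q\<^sub>A\<^sup>T" unfolding A_eq by (rule transpose_mult[OF QA R])
  have "(A\<^sup>T * A) *\<^sub>v x = A\<^sup>T *\<^sub>v (A *\<^sub>v x)"
    by (rule assoc_mult_mat_vec[OF _ A x]) (use A in auto)
  also have "\<dots> = R\<^sup>T *\<^sub>v (Q\<^sub>A\<^sup>T *\<^sub>v (Q\<^sub>A *\<^sub>v y))"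
    unfolding Ax AT by (rule assoc_mult_mat_vec[OF RT QAT]) (use QA y in auto)
  finally have AAx: "(A\<^sup>T * A) *\<^sub>v x = R\<^sup>T *\<^sub>v (Q\<^sub>A\<^sup>T *\<^sub>v (Q\<^sub>A *\<^sub>v y))" .
  have "(\<sigma> \<cdot>\<^sub>m (A\<^sup>T * A) - \<gamma> \<cdot>\<^sub>m (L\<^sup>T * L)) *\<^sub>v x
      = \<sigma> \<cdot>\<^sub>v ((A\<^sup>T * A) *\<^sub>v x) - \<gamma> \<cdot>\<^sub>v ((L\<^sup>T * L) *\<^sub>v x)"
    using minus_mult_distrib_mat_vec[of "\<sigma> \<cdot>\<^sub>m (A\<^sup>T * A)" n n "\<gamma> \<cdot>\<^sub>m (L\<^sup>T * L)" x] AA LL x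
    by (simp add: smult_mat_mult_vec[OF AA x] smult_mat_mult_vec[OF LL x])
  also have "\<dots> = (A\<^sup>T * A) *\<^sub>v x - \<gamma> \<cdot>\<^sub>v (R\<^sup>T *\<^sub>v y)"
    unfolding sum[symmetric] sc using A L x
    by (intro eq_vecI) (simp_all add: algebra_simps del: index_mult_mat_vec)
  also have "\<dots> = R\<^sup>T *\<^sub>v (Q\<^sub>A\<^sup>T *\<^sub>v (Q\<^sub>A *\<^sub>v y) - \<gamma> \<cdot>\<^sub>v y)"
    unfolding AAx mult_mat_vec[OF RT y, symmetric]
    by (rule mult_minus_distrib_mat_vec[OF RT, symmetric]) (use QAT y in auto)
  finally show ?thesis unfolding x_def .
qed

section \<open>Joint bidiagonalization in finite precision\<close>

lemma first_cols_carrier: "first_cols N x j \<in> carrier_mat N j"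
  unfolding first_cols_def using mat_of_cols_carrier(1)[of N "map x [1..<j + 1]"]
  by (simp del: upt_Suc)

lemma first_cols_mult:
  assumes Q: "Q \<in> carrier_mat n N" and v: "\<And>j. j \<in> {1..k} \<Longrightarrow> v j \<in> carrier_vec N"
  shows "first_cols n (\<lambda>j. Q *\<^sub>v v j) k = Q * first_cols N v k"
proof (rule eq_matI)
  fix i j assume "i < dim_row (Q * first_cols N v k)" "j < dim_col (Q * first_cols N v k)"
  then have ij: "i < n" "j < k" using Q first_cols_carrier[of N v k] by auto
  have vj: "v (Suc j) \<in> carrier_vec N" using v ij by simp
  then have "col (first_cols N v k) j = v (Suc j)"
    using ij unfolding first_cols_def by (subst col_mat_of_cols) (auto simp del: upt_Suc)
  then show "first_cols n (\<lambda>j. Q *\<^sub>v v j) k $$ (i, j) = (Q * first_cols N v k) $$ (i, j)"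
    using ij Q first_cols_carrier[of N v k]
    by (simp add: first_cols_def mat_of_cols_index del: upt_Suc)
qed (use Q first_cols_carrier[of N v k] first_cols_carrier[of n "\<lambda>j. Q *\<^sub>v v j" k] in auto)

lemma rank_one_mult_vec:
  fixes v e z :: "real vec"
  assumes "v \<in> carrier_vec N" "e \<in> carrier_vec l" "z \<in> carrier_vec l"
  shows "(\<alpha> \<cdot>\<^sub>m (mat_of_cols N [v] * mat_of_rows l [e])) *\<^sub>v z = (\<alpha> * (e \<bullet> z)) \<cdot>\<^sub>v v"
proof -
  have C: "mat_of_cols N [v] \<in> carrier_mat N 1" and E: "mat_of_rows l [e] \<in> carrier_mat 1 l"
    using mat_of_cols_carrier(1)[of N "[v]"] mat_of_rows_carrier(1)[of l "[e]"] by auto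
  have ez: "mat_of_rows l [e] *\<^sub>v z = vec 1 (\<lambda>_. e \<bullet> z)"
    using assms by (intro eq_vecI) auto
  have "(mat_of_cols N [v] * mat_of_rows l [e]) *\<^sub>v z = (e \<bullet> z) \<cdot>\<^sub>v v"
    unfolding assoc_mult_mat_vec[OF C E assms(3)] ez
    using assms by (intro eq_vecI) (auto simp: scalar_prod_def mat_of_cols_index)
  then show ?thesis
    using smult_mat_mult_vec[OF mult_carrier_mat[OF C E] assms(3), of \<alpha>]
    by (simp add: smult_smult_assoc)
qed

text \<open>Lemma \<open>perturbed_projection_residual\<close> is applied to \<open>q = V w\<close>, \<open>a = U B w\<close> and \<open>b = U z\<close>, where
  \<open>B\<^sup>T z = w\<close> and the last entry of \<open>z\<close> is zero.  The lower bound for \<open>\<parallel>Bu_mat\<inverse>\<parallel>\<close> is proved along the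
  way, since it concerns the same \<open>z\<close>.\<close>

lemma JBD_projected_residual_le:
  fixes Q :: "real mat" and k :: nat
  assumes k: "1 \<le> k"
    and QA: "Q\<^sub>A \<in> carrier_mat m n" and QL: "Q\<^sub>L \<in> carrier_mat p n"
    and Q_def: "Q = Q\<^sub>A @\<^sub>r Q\<^sub>L" and QQ: "Q\<^sup>T * Q = 1\<^sub>m n"
    and jbd: "JBD_finite_precision m n p k C\<^sub>F C\<^sub>G C\<^sub>o c1 \<delta> \<epsilon> Q u v \<alpha> \<beta> F G"
    and inv: "invertible_mat (Bu_mat \<alpha> \<beta> k)"
    and svd: "compact_SVD_B k (B_mat \<alpha> \<beta> k) P c W" and i: "i \<in> {1..k}"
    and y_def: "y = Q\<^sup>T *\<^sub>v (first_cols (m + p) v k *\<^sub>v col W (i - 1))"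
  shows "vec_norm2 (Q\<^sub>A\<^sup>T *\<^sub>v (Q\<^sub>A *\<^sub>v y) - (c i)\<^sup>2 \<cdot>\<^sub>v y)
    \<le> \<alpha> (k + 1) * \<beta> (k + 1) * \<bar>last_unit k \<bullet> col W (i - 1)\<bar>
      + (C\<^sub>G + C\<^sub>F) * \<epsilon> + 2 * C\<^sub>G * (mat_norm2 (mat_inv (Bu_mat \<alpha> \<beta> k)) * \<epsilon>)"
    and "1 \<le> mat_norm2 (mat_inv (Bu_mat \<alpha> \<beta> k))"
proof -
  define U where "U = first_cols m u (k + 1)"
  define V where "V = first_cols (m + p) v k"
  define B where "B = B_mat \<alpha> \<beta> k"
  define J where "J = top_block m p"
  define w where "w = col W (i - 1)"
  define \<kappa> where "\<kappa> = mat_norm2 (mat_inv (Bu_mat \<alpha> \<beta> k))"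
  have Q: "Q \<in> carrier_mat (m + p) n" unfolding Q_def using QA QL by (rule carrier_append_rows)
  have J: "J \<in> carrier_mat m (m + p)" unfolding J_def by (rule top_block_carrier)
  have QT: "Q\<^sup>T \<in> carrier_mat n (m + p)" and JT: "J\<^sup>T \<in> carrier_mat (m + p) m" using Q J by auto
  have U: "U \<in> carrier_mat m (k + 1)" and V: "V \<in> carrier_mat (m + p) k"
    unfolding U_def V_def by (rule first_cols_carrier)+
  have B: "B \<in> carrier_mat (k + 1) k" and BT: "B\<^sup>T \<in> carrier_mat k (k + 1)"
    unfolding B_def using B_mat_carrier[of \<alpha> \<beta> k] by auto
  have F: "F \<in> carrier_mat m k" and G: "G \<in> carrier_mat (m + p) (k + 1)"
    and F_le: "mat_norm2 F \<le> C\<^sub>F * \<epsilon>" and G_le: "mat_norm2 G \<le> C\<^sub>G * \<epsilon>"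
    and ab: "0 \<le> \<alpha> (k + 1)" "0 \<le> \<beta> (k + 1)"
    and v: "v (k + 1) \<in> carrier_vec (m + p)" "vec_norm2 (v (k + 1)) = 1"
    and rec1: "J * V = U * B + F"
    and rec2: "Q * Q\<^sup>T * (J\<^sup>T * U) = V * B\<^sup>T
         + \<alpha> (k + 1) \<cdot>\<^sub>m (mat_of_cols (m + p) [v (k + 1)] * mat_of_rows (k + 1) [last_unit (k + 1)])
         + G"
    using jbd k top_block_transpose_mult[OF U, of p]
    unfolding JBD_finite_precision_def top_block_def[symmetric]
    by (auto simp: U_def V_def B_def J_def)
  have rec2_vec: "Q *\<^sub>v (Q\<^sup>T *\<^sub>v (J\<^sup>T *\<^sub>v (U *\<^sub>v z)))
      = V *\<^sub>v (B\<^sup>T *\<^sub>v z) + (\<alpha> (k + 1) * (last_unit (k + 1) \<bullet> z)) \<cdot>\<^sub>v v (k + 1) + G *\<^sub>v z"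
    if z: "z \<in> carrier_vec (k + 1)" for z
  proof -
    let ?M = "\<alpha> (k + 1) \<cdot>\<^sub>m (mat_of_cols (m + p) [v (k + 1)] * mat_of_rows (k + 1) [last_unit (k + 1)])"
    have M: "?M \<in> carrier_mat (m + p) (k + 1)" by auto
    have VB: "V * B\<^sup>T \<in> carrier_mat (m + p) (k + 1)" using V BT by simp
    have "Q *\<^sub>v (Q\<^sup>T *\<^sub>v (J\<^sup>T *\<^sub>v (U *\<^sub>v z))) = (Q * Q\<^sup>T * (J\<^sup>T * U)) *\<^sub>v z"
      using assoc_mult_mat_vec[OF mult_carrier_mat[OF Q QT] mult_carrier_mat[OF JT U] z]
        assoc_mult_mat_vec[OF JT U z] assoc_mult_mat_vec[OF Q QT, of "J\<^sup>T *\<^sub>v (U *\<^sub>v z)"]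
        U JT z by simp
    also have "\<dots> = V *\<^sub>v (B\<^sup>T *\<^sub>v z) + ?M *\<^sub>v z + G *\<^sub>v z"
      unfolding rec2 using add_mult_distrib_mat_vec[OF add_carrier_mat[OF M] G z, of "V * B\<^sup>T"]
        add_mult_distrib_mat_vec[OF VB M z] assoc_mult_mat_vec[OF V BT z] by simp
    finally show ?thesis
      unfolding rank_one_mult_vec[OF v(1) last_unit_carrier z] .
  qed
  have w: "w \<in> carrier_vec k" "vec_norm2 w = 1" "B\<^sup>T *\<^sub>v (B *\<^sub>v w) = (c i)\<^sup>2 \<cdot>\<^sub>v w"
    unfolding w_def B_def using compact_SVD_B_singular_vector[OF svd i] by auto
  have contr: "vec_norm2 (B *\<^sub>v x) \<le> 1 * vec_norm2 x" if "x \<in> carrier_vec k" for x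
    unfolding B_def using compact_SVD_B_contraction[OF svd that] by simp
  have Bw: "B *\<^sub>v w \<in> carrier_vec (k + 1)" using B w by simp
  have Bw_le: "vec_norm2 (B *\<^sub>v w) \<le> 1" using contr[OF w(1)] w(2) by simp
  have Bu: "Bu_mat \<alpha> \<beta> k \<in> carrier_mat k k" using k by (rule Bu_mat_carrier)
  note Bu_inv = mat_inv_inverse[OF Bu inv]
  define t where "t = mat_inv (Bu_mat \<alpha> \<beta> k) *\<^sub>v w"
  define z where "z = t @\<^sub>v 0\<^sub>v 1"
  have t: "t \<in> carrier_vec k" unfolding t_def using Bu_inv(1) w by simp
  have z: "z \<in> carrier_vec (k + 1)" unfolding z_def using t by (intro append_carrier_vec) auto
  have "Bu_mat \<alpha> \<beta> k *\<^sub>v t = w"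
    unfolding t_def using assoc_mult_mat_vec[OF Bu Bu_inv(1) w(1)] Bu_inv(2) w by simp
  then have BTz: "B\<^sup>T *\<^sub>v z = w"
    unfolding z_def B_def using B_mat_transpose_mult_append_zero[OF k t] by simp
  \<comment> \<open>The zero entry makes the term with the next vector of the process vanish in the second recurrence.\<close>
  have ez: "last_unit (k + 1) \<bullet> z = 0"
    unfolding z_def by (rule last_unit_append_zero[OF t])
  have "vec_norm2 t \<le> \<kappa> * vec_norm2 w"
    unfolding t_def \<kappa>_def by (rule vec_norm2_mult_mat_vec_le[OF Bu_inv(1) w(1)])
  then have z_le: "vec_norm2 z \<le> \<kappa>"
    unfolding z_def vec_norm2_append_zero[OF t] w by simp
  have "vec_norm2 (B\<^sup>T *\<^sub>v z) \<le> 1 * vec_norm2 z"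
    by (rule vec_norm2_transpose_mult_le[OF B z _ contr]) simp_all
  then show "1 \<le> mat_norm2 (mat_inv (Bu_mat \<alpha> \<beta> k))"
    using z_le w unfolding BTz \<kappa>_def by simp
  have zero_v: "0 \<cdot>\<^sub>v v (k + 1) = 0\<^sub>v (m + p)" using v(1) by auto
  define q where "q = V *\<^sub>v w"
  have q: "q \<in> carrier_vec (m + p)" unfolding q_def using V w by simp
  have y: "y = Q\<^sup>T *\<^sub>v q" unfolding y_def q_def V_def w_def ..
  have QA_eq: "Q\<^sub>A = J * Q"
    unfolding Q_def J_def using top_block_mult_append_rows[OF QA QL] by simp
  have yc: "y \<in> carrier_vec n" unfolding y using QT q by simp
  have QAQA: "Q\<^sub>A\<^sup>T *\<^sub>v (Q\<^sub>A *\<^sub>v y) = Q\<^sup>T *\<^sub>v (J\<^sup>T *\<^sub>v (J *\<^sub>v (Q *\<^sub>v y)))"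
    unfolding QA_eq transpose_mult[OF J Q]
    using assoc_mult_mat_vec[OF J Q yc] assoc_mult_mat_vec[OF QT JT, of "J *\<^sub>v (Q *\<^sub>v y)"] J Q yc
    by simp
  have "vec_norm2 (Q\<^sup>T *\<^sub>v (J\<^sup>T *\<^sub>v (J *\<^sub>v (Q *\<^sub>v (Q\<^sup>T *\<^sub>v q)))) - (c i)\<^sup>2 \<cdot>\<^sub>v (Q\<^sup>T *\<^sub>v q))
    \<le> \<bar>\<alpha> (k + 1) * (last_unit (k + 1) \<bullet> (B *\<^sub>v w))\<bar> * vec_norm2 (v (k + 1))
      + vec_norm2 (G *\<^sub>v (B *\<^sub>v w)) + vec_norm2 (F *\<^sub>v w) + 2 * vec_norm2 (G *\<^sub>v z)"
  proof (rule perturbed_projection_residual[OF Q QQ J])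
    show "J * J\<^sup>T = 1\<^sub>m m" unfolding J_def by (rule top_block_coisometry)
    show "J *\<^sub>v q = U *\<^sub>v (B *\<^sub>v w) + F *\<^sub>v w"
      using assoc_mult_mat_vec[OF J V w(1)] rec1 assoc_mult_mat_vec[OF U B w(1)]
        add_mult_distrib_mat_vec[OF mult_carrier_mat[OF U B] F w(1)] by (simp add: q_def)
    show "Q *\<^sub>v (Q\<^sup>T *\<^sub>v (J\<^sup>T *\<^sub>v (U *\<^sub>v (B *\<^sub>v w))))
        = (c i)\<^sup>2 \<cdot>\<^sub>v q + (\<alpha> (k + 1) * (last_unit (k + 1) \<bullet> (B *\<^sub>v w))) \<cdot>\<^sub>v v (k + 1) + G *\<^sub>v (B *\<^sub>v w)"
      unfolding rec2_vec[OF Bw] w(3) mult_mat_vec[OF V w(1)] q_def ..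
    show "Q *\<^sub>v (Q\<^sup>T *\<^sub>v (J\<^sup>T *\<^sub>v (U *\<^sub>v z))) = q + G *\<^sub>v z"
      using rec2_vec[OF z] q unfolding BTz ez mult_zero_right zero_v q_def[symmetric] by simp
  qed (use q v U F G Bw w z in auto)
  also have "\<dots> \<le> \<alpha> (k + 1) * \<beta> (k + 1) * \<bar>last_unit k \<bullet> w\<bar>
      + C\<^sub>G * \<epsilon> + C\<^sub>F * \<epsilon> + 2 * (C\<^sub>G * \<epsilon> * \<kappa>)"
  proof (intro add_mono mult_left_mono)
    show "\<bar>\<alpha> (k + 1) * (last_unit (k + 1) \<bullet> (B *\<^sub>v w))\<bar> * vec_norm2 (v (k + 1))
        \<le> \<alpha> (k + 1) * \<beta> (k + 1) * \<bar>last_unit k \<bullet> w\<bar>"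
      unfolding B_def last_unit_B_mat_mult[OF k w(1)] using v ab by (simp add: abs_mult)
    have CG: "0 \<le> C\<^sub>G * \<epsilon>" using G_le mat_norm2_nonneg[of G] by linarith
    have "vec_norm2 (G *\<^sub>v (B *\<^sub>v w)) \<le> mat_norm2 G * vec_norm2 (B *\<^sub>v w)"
      by (rule vec_norm2_mult_mat_vec_le[OF G Bw])
    also have "\<dots> \<le> C\<^sub>G * \<epsilon> * 1"
      by (rule mult_mono[OF G_le Bw_le CG vec_norm2_nonneg])
    finally show "vec_norm2 (G *\<^sub>v (B *\<^sub>v w)) \<le> C\<^sub>G * \<epsilon>" by simp
    show "vec_norm2 (F *\<^sub>v w) \<le> C\<^sub>F * \<epsilon>"
      using vec_norm2_mult_mat_vec_le[OF F w(1)] F_le w(2) by simp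
    have "vec_norm2 (G *\<^sub>v z) \<le> mat_norm2 G * vec_norm2 z"
      by (rule vec_norm2_mult_mat_vec_le[OF G z])
    also have "\<dots> \<le> C\<^sub>G * \<epsilon> * \<kappa>"
      by (rule mult_mono[OF G_le z_le CG vec_norm2_nonneg])
    finally show "vec_norm2 (G *\<^sub>v z) \<le> C\<^sub>G * \<epsilon> * \<kappa>" .
  qed simp
  finally show "vec_norm2 (Q\<^sub>A\<^sup>T *\<^sub>v (Q\<^sub>A *\<^sub>v y) - (c i)\<^sup>2 \<cdot>\<^sub>v y)
    \<le> \<alpha> (k + 1) * \<beta> (k + 1) * \<bar>last_unit k \<bullet> col W (i - 1)\<bar>
      + (C\<^sub>G + C\<^sub>F) * \<epsilon> + 2 * C\<^sub>G * (mat_norm2 (mat_inv (Bu_mat \<alpha> \<beta> k)) * \<epsilon>)"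
    unfolding QAQA unfolding y w_def[symmetric] \<kappa>_def[symmetric] by (simp add: algebra_simps)
qed

lemma JBD_gsv_residual_le:
  assumes k: "1 \<le> k" and C: "0 \<le> C\<^sub>F" "0 \<le> C\<^sub>G" and eps: "0 < \<epsilon>"
    and A: "A \<in> carrier_mat m n" and L: "L \<in> carrier_mat p n"
    and qr: "compact_QR m n p A L Q\<^sub>A Q\<^sub>L R"
    and jbd: "JBD_finite_precision m n p k C\<^sub>F C\<^sub>G C\<^sub>o c1 \<delta> \<epsilon> (Q\<^sub>A @\<^sub>r Q\<^sub>L) u v \<alpha> \<beta> F G"
    and inv: "invertible_mat (Bu_mat \<alpha> \<beta> k)"
    and svd: "compact_SVD_B k (B_mat \<alpha> \<beta> k) P c W"
    and s: "\<sigma> = 1 - (c i)\<^sup>2" and i: "i \<in> {1..k}"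
  shows "vec_norm2 ((\<sigma> \<cdot>\<^sub>m (A\<^sup>T * A) - (c i)\<^sup>2 \<cdot>\<^sub>m (L\<^sup>T * L))
                 *\<^sub>v approx_gsv_vector n k (Q\<^sub>A @\<^sub>r Q\<^sub>L) R v W i)
      \<le> mat_norm2 R * (\<alpha> (k + 1) * \<beta> (k + 1) * \<bar>last_unit k \<bullet> col W (i - 1)\<bar>
                       + (3 * C\<^sub>G + C\<^sub>F) * (mat_norm2 (mat_inv (Bu_mat \<alpha> \<beta> k)) * \<epsilon>))"
proof -
  define Q where "Q = Q\<^sub>A @\<^sub>r Q\<^sub>L"
  define \<kappa> where "\<kappa> = mat_norm2 (mat_inv (Bu_mat \<alpha> \<beta> k))"
  define \<eta> where "\<eta> = \<alpha> (k + 1) * \<beta> (k + 1) * \<bar>last_unit k \<bullet> col W (i - 1)\<bar>"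
  have QA: "Q\<^sub>A \<in> carrier_mat m n" and QL: "Q\<^sub>L \<in> carrier_mat p n" and R: "R \<in> carrier_mat n n"
    and QQ: "Q\<^sup>T * Q = 1\<^sub>m n"
    using qr by (auto simp: compact_QR_def Q_def)
  have QT: "Q\<^sup>T \<in> carrier_mat n (m + p)"
    unfolding Q_def using carrier_append_rows[OF QA QL] by simp
  define V where "V = first_cols (m + p) v k"
  define y where "y = Q\<^sup>T *\<^sub>v (V *\<^sub>v col W (i - 1))"
  have V: "V \<in> carrier_mat (m + p) k" unfolding V_def by (rule first_cols_carrier)
  have w: "col W (i - 1) \<in> carrier_vec k" by (rule compact_SVD_B_singular_vector(1)[OF svd i])
  have y: "y \<in> carrier_vec n" unfolding y_def using QT V w by simp
  have v: "v j \<in> carrier_vec (m + p)" if "j \<in> {1..k}" for j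
    using jbd that by (auto simp: JBD_finite_precision_def)
  have "first_cols n (\<lambda>j. Q\<^sup>T *\<^sub>v v j) k = Q\<^sup>T * V"
    unfolding V_def by (rule first_cols_mult[OF QT]) (rule v)
  then have "first_cols n (\<lambda>j. Q\<^sup>T *\<^sub>v v j) k *\<^sub>v col W (i - 1) = y"
    using assoc_mult_mat_vec[OF QT V w] by (simp add: y_def)
  then have x: "approx_gsv_vector n k (Q\<^sub>A @\<^sub>r Q\<^sub>L) R v W i = mat_inv R *\<^sub>v y"
    by (simp add: approx_gsv_vector_def Q_def)
  define r where "r = Q\<^sub>A\<^sup>T *\<^sub>v (Q\<^sub>A *\<^sub>v y) - (c i)\<^sup>2 \<cdot>\<^sub>v y"
  have r: "r \<in> carrier_vec n" unfolding r_def using y QA by simp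
  note bounds = JBD_projected_residual_le[OF k QA QL Q_def QQ jbd[folded Q_def] inv svd i
      y_def[unfolded V_def], folded r_def \<kappa>_def \<eta>_def]
  \<comment> \<open>Errors that do not see the inverse are absorbed because its norm \<open>\<kappa>\<close> is at least 1.\<close>
  have "(C\<^sub>G + C\<^sub>F) * \<epsilon> \<le> (C\<^sub>G + C\<^sub>F) * (\<kappa> * \<epsilon>)"
    using mult_right_mono[OF bounds(2), of \<epsilon>] eps C by (intro mult_left_mono) auto
  then have r_le: "vec_norm2 r \<le> \<eta> + (3 * C\<^sub>G + C\<^sub>F) * (\<kappa> * \<epsilon>)"
    using bounds(1) by (simp add: algebra_simps)
  have "vec_norm2 (R\<^sup>T *\<^sub>v r) \<le> mat_norm2 R * vec_norm2 r"
    by (rule vec_norm2_transpose_mult_le[OF R r mat_norm2_nonneg vec_norm2_mult_mat_vec_le[OF R]])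
  also have "\<dots> \<le> mat_norm2 R * (\<eta> + (3 * C\<^sub>G + C\<^sub>F) * (\<kappa> * \<epsilon>))"
    by (rule mult_left_mono[OF r_le mat_norm2_nonneg])
  finally show "vec_norm2 ((\<sigma> \<cdot>\<^sub>m (A\<^sup>T * A) - (c i)\<^sup>2 \<cdot>\<^sub>m (L\<^sup>T * L))
               *\<^sub>v approx_gsv_vector n k (Q\<^sub>A @\<^sub>r Q\<^sub>L) R v W i)
    \<le> mat_norm2 R * (\<alpha> (k + 1) * \<beta> (k + 1) * \<bar>last_unit k \<bullet> col W (i - 1)\<bar>
                     + (3 * C\<^sub>G + C\<^sub>F) * (mat_norm2 (mat_inv (Bu_mat \<alpha> \<beta> k)) * \<epsilon>))"
    using gsv_residual_eq[OF A L qr y s]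
    unfolding x r_def \<eta>_def \<kappa>_def by simp
qed

theorem theorem4p3:
  fixes k :: nat and C\<^sub>F C\<^sub>G C\<^sub>o c1 :: real
  assumes "1 \<le> k" "0 \<le> C\<^sub>F" "0 \<le> C\<^sub>G" "0 \<le> C\<^sub>o" "0 \<le> c1"
  shows "\<exists>K\<ge>0. \<forall>\<delta>>0. \<exists>\<epsilon>0>0. \<forall>\<epsilon> m n p A L Q\<^sub>A Q\<^sub>L R u v \<alpha> \<beta> F G P c W s i.
    0 < \<epsilon> \<and> \<epsilon> < \<epsilon>0 \<and>
    A \<in> carrier_mat m n \<and> L \<in> carrier_mat p n \<and>
    vec_space.rank (m + p) (A @\<^sub>r L) = n \<and>
    compact_QR m n p A L Q\<^sub>A Q\<^sub>L R \<and>
    JBD_finite_precision m n p k C\<^sub>F C\<^sub>G C\<^sub>o c1 \<delta> \<epsilon> (Q\<^sub>A @\<^sub>r Q\<^sub>L) u v \<alpha> \<beta> F G \<and>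
    invertible_mat (Bu_mat \<alpha> \<beta> k) \<and>
    compact_SVD_B k (B_mat \<alpha> \<beta> k) P c W \<and>
    (\<forall>j\<in>{1..k}. (s j)\<^sup>2 = 1 - (c j)\<^sup>2) \<and>
    i \<in> {1..k}
    \<longrightarrow>
    vec_norm2 (((s i)\<^sup>2 \<cdot>\<^sub>m (A\<^sup>T * A) - (c i)\<^sup>2 \<cdot>\<^sub>m (L\<^sup>T * L))
                 *\<^sub>v approx_gsv_vector n k (Q\<^sub>A @\<^sub>r Q\<^sub>L) R v W i)
      \<le> mat_norm2 R * (\<alpha> (k + 1) * \<beta> (k + 1) * \<bar>last_unit k \<bullet> col W (i - 1)\<bar>
                       + K * (mat_norm2 (mat_inv (Bu_mat \<alpha> \<beta> k)) * \<epsilon>))"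
proof (rule exI[of _ "3 * C\<^sub>G + C\<^sub>F"], intro conjI allI impI)
  show "0 \<le> 3 * C\<^sub>G + C\<^sub>F" using assms by simp
  \<comment> \<open>The threshold 1 is arbitrary: with this constant the estimate is not merely asymptotic.\<close>
qed (rule exI[of _ 1], intro conjI allI impI, simp, elim conjE,
    rule JBD_gsv_residual_le[OF assms(1,2,3)], assumption+, erule bspec, assumption+)

end
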